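(* Let $\bar{X} = (X,\Sigma_X,\mathbb{P}_X)$ be a probability space and let $Id_X^- : \bar{X} \to \bar{X}$ be the identity arrow of $\bar{X}$ in the category $\mathbf{Prob}$. For every $u \in \mathcal{L}^1(\bar{X})$, $E^{Id_X^-}(u) \sim_{\mathbb{P}_X} u$.
   Context: The category $\mathbf{Prob}$ has all probability spaces $\bar{X} = (X,\Sigma_X,\mathbb{P}_X)$ as objects; an arrow $f^- : \bar{X} \to \bar{Y}$ is a symbol corresponding uniquely to a measurable function $f : Y \to X$ (note the reversed direction) that is null-preserving, i.e. $\mathbb{P}_X(A)=0$ implies $\mathbb{P}_Y(f^{-1}(A))=0$ for $A \in \Sigma_X$. Composition is $g^- \circ f^- = (f \circ g)^-$, and the identity arrow $Id_X^-$ corresponds to the identity function of $X$. $\mathcal{L}^1(\bar{X})$ is the vector space of $\mathbb{R}$-valued random variables on $\bar{X}$ integrable with respect to $\mathbb{P}_X$. For random variables, $u_1 \sim_{\mathbb{P}_X} u_2$ means $\mathbb{P}_X(u_1 \ne u_2) = 0$. Conditional expectation along an arrow: for $f^- : \bar{X} \to \bar{Y}$ in $\mathbf{Prob}$ and $v \in \mathcal{L}^1(\bar{Y})$, $E^{f^-}(v)$ denotes the element of $\mathcal{L}^1(\bar{X})$, unique up to $\mathbb{P}_X$-a.s. equality (it exists by the Radon-Nikodym theorem), such that $\int_A E^{f^-}(v)\, d\mathbb{P}_X = \int_{f^{-1}(A)} v \, d\mathbb{P}_Y$ for all $A \in \Sigma_X$. *)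

theory Defs
  imports "HOL-Probability.Probability"
begin

section \<open>The category of probability spaces\<close>

text \<open>
  Objects are measures satisfying \<^const>\<open>prob_space\<close>. An arrow from \<open>X\<close> to \<open>Y\<close> is carried by a
  function in the reverse direction, from \<open>space Y\<close> to \<open>space X\<close>. HOL functions are total, so the
  function is required to be \<^const>\<open>extensional\<close>: this makes an arrow correspond uniquely to a
  function between the carriers.
\<close>

datatype ('a, 'b) prob_arrow =
  Prob_Arrow (arr_dom: "'a measure") (arr_cod: "'b measure") (arr_fun: "'b \<Rightarrow> 'a")

definition null_preserving :: "'a measure \<Rightarrow> 'b measure \<Rightarrow> ('b \<Rightarrow> 'a) \<Rightarrow> bool" where
  "null_preserving X Y f \<longleftrightarrow>
     (\<forall>A \<in> sets X. measure X A = 0 \<longrightarrow> measure Y (f -` A \<inter> space Y) = 0)"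

definition prob_hom :: "'a measure \<Rightarrow> 'b measure \<Rightarrow> ('a, 'b) prob_arrow set" where
  "prob_hom X Y =
     {Prob_Arrow X Y f | f. prob_space X \<and> prob_space Y \<and>
        f \<in> measurable Y X \<and> f \<in> extensional (space Y) \<and> null_preserving X Y f}"

definition prob_id :: "'a measure \<Rightarrow> ('a, 'a) prob_arrow" where
  "prob_id X = Prob_Arrow X X (\<lambda>x\<in>space X. x)"

text \<open>\<open>prob_comp G F\<close> is the composite of \<open>F : X \<rightarrow> Y\<close> followed by \<open>G : Y \<rightarrow> Z\<close>.\<close>

definition prob_comp :: "('b, 'c) prob_arrow \<Rightarrow> ('a, 'b) prob_arrow \<Rightarrow> ('a, 'c) prob_arrow" where
  "prob_comp G F =
     Prob_Arrow (arr_dom F) (arr_cod G) (compose (space (arr_cod G)) (arr_fun F) (arr_fun G))"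

lemma prob_id_in_hom:
  assumes "prob_space X"
  shows "prob_id X \<in> prob_hom X X"
proof -
  have "(\<lambda>x\<in>space X. x) \<in> measurable X X"
    using measurable_cong[of X "\<lambda>x\<in>space X. x" "\<lambda>x. x" X] by simp
  moreover have "(\<lambda>x\<in>space X. x) -` A \<inter> space X = A" if "A \<in> sets X" for A
    using sets.sets_into_space[OF that] by auto
  ultimately show ?thesis
    using assms by (auto simp: prob_id_def prob_hom_def null_preserving_def)
qed

lemma prob_comp_in_hom:
  assumes "F \<in> prob_hom X Y" and "G \<in> prob_hom Y Z"
  shows "prob_comp G F \<in> prob_hom X Z"
proof -
  obtain f where F: "F = Prob_Arrow X Y f" and f: "f \<in> measurable Y X" "null_preserving X Y f"
    and X: "prob_space X"
    using assms(1) by (auto simp: prob_hom_def)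
  obtain g where G: "G = Prob_Arrow Y Z g" and g: "g \<in> measurable Z Y" "null_preserving Y Z g"
    and Z: "prob_space Z"
    using assms(2) by (auto simp: prob_hom_def)
  have "compose (space Z) f g \<in> measurable Z X"
    using measurable_comp[OF g(1) f(1)]
      measurable_cong[of Z "compose (space Z) f g" "f \<circ> g" X]
    by (simp add: compose_def)
  moreover have "null_preserving X Z (compose (space Z) f g)"
    unfolding null_preserving_def
  proof (intro ballI impI)
    fix A assume A: "A \<in> sets X" "measure X A = 0"
    have eq: "compose (space Z) f g -` A \<inter> space Z = g -` (f -` A \<inter> space Y) \<inter> space Z"
      using measurable_space[OF g(1)] by (auto simp: compose_def)
    have "f -` A \<inter> space Y \<in> sets Y" "measure Y (f -` A \<inter> space Y) = 0"
      using A f measurable_sets by (auto simp: null_preserving_def)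
    then show "measure Z (compose (space Z) f g -` A \<inter> space Z) = 0"
      using g(2) eq by (auto simp: null_preserving_def)
  qed
  ultimately show ?thesis
    using X Z by (auto simp: F G prob_comp_def prob_hom_def)
qed

lemma prob_comp_id_left:
  assumes "F \<in> prob_hom X Y"
  shows "prob_comp (prob_id Y) F = F"
  using assms
  by (auto simp: prob_hom_def prob_comp_def prob_id_def compose_def extensional_def fun_eq_iff)

lemma prob_comp_id_right:
  assumes "F \<in> prob_hom X Y"
  shows "prob_comp F (prob_id X) = F"
  using assms
  by (auto simp: prob_hom_def prob_comp_def prob_id_def compose_def extensional_def fun_eq_iff
      dest: measurable_space)


section \<open>Integrable random variables and almost sure equality\<close>

definition L1 :: "'a measure \<Rightarrow> ('a \<Rightarrow> real) set" where
  "L1 X = {u. integrable X u}"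

text \<open>Measurability is included because \<^const>\<open>measure\<close> is 0 on every non-measurable set.\<close>

definition rv_sim :: "'a measure \<Rightarrow> ('a \<Rightarrow> real) \<Rightarrow> ('a \<Rightarrow> real) \<Rightarrow> bool" where
  "rv_sim X u1 u2 \<longleftrightarrow>
     u1 \<in> borel_measurable X \<and> u2 \<in> borel_measurable X \<and>
     measure X {x \<in> space X. u1 x \<noteq> u2 x} = 0"


section \<open>Conditional expectation along an arrow\<close>

definition is_cond_exp_along ::
    "('a, 'b) prob_arrow \<Rightarrow> ('b \<Rightarrow> real) \<Rightarrow> ('a \<Rightarrow> real) \<Rightarrow> bool" where
  "is_cond_exp_along F v w \<longleftrightarrow>
     w \<in> L1 (arr_dom F) \<and>
     (\<forall>A \<in> sets (arr_dom F).
        (LINT x:A|arr_dom F. w x) =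
        (LINT y:(arr_fun F -` A \<inter> space (arr_cod F))|arr_cod F. v y))"

text \<open>
  The conditional expectation is only determined up to almost sure equality; the operator picks an
  arbitrary version. Existence and essential uniqueness of versions, for \<open>F \<in> prob_hom X Y\<close> and
  \<open>v \<in> L1 Y\<close>, are \<open>is_cond_exp_along_exists\<close> and \<open>is_cond_exp_along_unique\<close> below.
\<close>

definition cond_exp_along :: "('a, 'b) prob_arrow \<Rightarrow> ('b \<Rightarrow> real) \<Rightarrow> 'a \<Rightarrow> real" where
  "cond_exp_along F v = (SOME w. is_cond_exp_along F v w)"

lemma is_cond_exp_along_exists_nonneg:
  assumes F: "F \<in> prob_hom X Y" and v: "integrable Y v" and nn: "\<And>y. 0 \<le> v y"
  shows "\<exists>w. is_cond_exp_along F v w"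
proof -
  obtain f where Ff: "F = Prob_Arrow X Y f" and f[measurable]: "f \<in> measurable Y X"
    and np: "null_preserving X Y f" and X: "prob_space X" and Y: "prob_space Y"
    using F by (auto simp: prob_hom_def)
  interpret X: prob_space X by fact
  interpret Y: prob_space Y by fact
  have [measurable]: "v \<in> borel_measurable Y" using v by auto
  define N where "N = distr (density Y (\<lambda>y. ennreal (v y))) X f"
  have N: "emeasure N A = ennreal (LINT y:(f -` A \<inter> space Y)|Y. v y)"
    if A[measurable]: "A \<in> sets X" for A
  proof -
    have "emeasure N A = (\<integral>\<^sup>+y. ennreal (v y) * indicator (f -` A \<inter> space Y) y \<partial>Y)"
      by (simp add: N_def emeasure_distr emeasure_density)
    also have "\<dots> = (\<integral>\<^sup>+y. ennreal (indicator (f -` A \<inter> space Y) y * v y) \<partial>Y)"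
      by (intro nn_integral_cong) (auto simp: indicator_def)
    also have "\<dots> = ennreal (\<integral>y. indicator (f -` A \<inter> space Y) y * v y \<partial>Y)"
      using integrable_mult_indicator[of "f -` A \<inter> space Y" Y v] v nn
      by (intro nn_integral_eq_integral) auto
    finally show ?thesis by (simp add: set_lebesgue_integral_def)
  qed
  have "absolutely_continuous X N"
    unfolding absolutely_continuous_def
  proof
    fix A assume A: "A \<in> null_sets X"
    then have "A \<in> sets X" "measure X A = 0" by (auto simp: measure_def)
    then have "measure Y (f -` A \<inter> space Y) = 0"
      using np by (auto simp: null_preserving_def)
    then have "f -` A \<inter> space Y \<in> null_sets Y"
      using \<open>A \<in> sets X\<close> by (auto simp: Y.emeasure_eq_measure intro!: null_setsI)
    from AE_not_in[OF this] have "AE y in Y. indicator (f -` A \<inter> space Y) y *\<^sub>R v y = 0"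
      by (rule eventually_mono) simp
    then have "(LINT y:(f -` A \<inter> space Y)|Y. v y) = 0"
      unfolding set_lebesgue_integral_def by (rule integral_eq_zero_AE)
    then show "A \<in> null_sets N"
      using N[OF \<open>A \<in> sets X\<close>] \<open>A \<in> sets X\<close> by (auto simp: N_def intro!: null_setsI)
  qed
  then obtain h where h[measurable]: "h \<in> borel_measurable X" and hN: "density X h = N"
    using X.Radon_Nikodym[of N] by (auto simp: N_def)
  have "(\<integral>\<^sup>+x. h x \<partial>X) = emeasure N (space X)"
    by (simp add: hN[symmetric] emeasure_density cong: nn_integral_cong)
  then have fin: "(\<integral>\<^sup>+x. h x \<partial>X) \<noteq> \<infinity>" by (simp add: N)
  then have "AE x in X. h x \<noteq> \<infinity>" by (intro nn_integral_PInf_AE) auto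
  then have hr: "AE x in X. ennreal (enn2real (h x)) = h x"
    by eventually_elim (simp add: less_top)
  have int: "integrable X (\<lambda>x. enn2real (h x))"
    using fin nn_integral_cong_AE[OF hr]
    by (intro integrableI_nonneg) (auto simp: less_top)
  have "(LINT x:A|X. enn2real (h x)) = (LINT y:(f -` A \<inter> space Y)|Y. v y)"
    if A[measurable]: "A \<in> sets X" for A
  proof -
    have "ennreal (LINT x:A|X. enn2real (h x)) = (\<integral>\<^sup>+x. ennreal (indicator A x * enn2real (h x)) \<partial>X)"
      unfolding set_lebesgue_integral_def
      using integrable_mult_indicator[OF A int]
      by (subst nn_integral_eq_integral) auto
    also have "\<dots> = (\<integral>\<^sup>+x. h x * indicator A x \<partial>X)"
      using hr by (intro nn_integral_cong_AE) (auto simp: indicator_def elim!: eventually_mono)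
    also have "\<dots> = emeasure N A"
      by (simp add: hN[symmetric] emeasure_density)
    finally have "ennreal (LINT x:A|X. enn2real (h x)) = ennreal (LINT y:(f -` A \<inter> space Y)|Y. v y)"
      by (simp add: N)
    then show ?thesis
      using nn by (subst (asm) ennreal_inj)
        (auto simp: set_lebesgue_integral_def intro!: integral_nonneg_AE)
  qed
  then show ?thesis
    using int by (intro exI[of _ "\<lambda>x. enn2real (h x)"]) (auto simp: is_cond_exp_along_def Ff L1_def)
qed

lemma is_cond_exp_along_exists:
  assumes F: "F \<in> prob_hom X Y" and v: "v \<in> L1 Y"
  shows "\<exists>w. is_cond_exp_along F v w"
proof -
  have v': "integrable Y v" using v by (simp add: L1_def)
  let ?p = "\<lambda>y. max 0 (v y)" and ?n = "\<lambda>y. max 0 (- v y)"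
  have i: "integrable Y ?p" "integrable Y ?n" using v' by auto
  obtain a where a: "is_cond_exp_along F ?p a"
    using is_cond_exp_along_exists_nonneg[OF F i(1)] by auto
  obtain b where b: "is_cond_exp_along F ?n b"
    using is_cond_exp_along_exists_nonneg[OF F i(2)] by auto
  obtain f where Ff: "F = Prob_Arrow X Y f" and f[measurable]: "f \<in> measurable Y X"
    using F by (auto simp: prob_hom_def)
  have ab: "integrable X a" "integrable X b"
    using a b by (auto simp: is_cond_exp_along_def Ff L1_def)
  have "(LINT x:A|X. a x - b x) = (LINT y:(f -` A \<inter> space Y)|Y. v y)"
    if A[measurable]: "A \<in> sets X" for A
  proof -
    have "(LINT x:A|X. a x - b x) = (LINT x:A|X. a x) - (LINT x:A|X. b x)"
      using ab by (intro set_integral_diff)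
        (auto simp: set_integrable_def intro!: integrable_mult_indicator[where 'b = real, simplified])
    also have "\<dots> = (LINT y:(f -` A \<inter> space Y)|Y. ?p y) - (LINT y:(f -` A \<inter> space Y)|Y. ?n y)"
      using a b A by (auto simp: is_cond_exp_along_def Ff)
    also have "\<dots> = (LINT y:(f -` A \<inter> space Y)|Y. ?p y - ?n y)"
      using i by (intro set_integral_diff(2)[symmetric])
        (auto simp: set_integrable_def intro!: integrable_mult_indicator[where 'b = real, simplified])
    also have "(\<lambda>y. ?p y - ?n y) = v" by auto
    finally show ?thesis .
  qed
  then show ?thesis
    using ab by (intro exI[of _ "\<lambda>x. a x - b x"]) (auto simp: is_cond_exp_along_def Ff L1_def)
qed

lemma is_cond_exp_along_unique:
  assumes "is_cond_exp_along F v w1" and "is_cond_exp_along F v w2"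
  shows "rv_sim (arr_dom F) w1 w2"
proof -
  have i[measurable]: "integrable (arr_dom F) w1" "integrable (arr_dom F) w2"
    using assms by (auto simp: is_cond_exp_along_def L1_def)
  have "AE x in arr_dom F. w1 x = w2 x"
    using assms by (intro density_unique_real i) (auto simp: is_cond_exp_along_def)
  then have "emeasure (arr_dom F) {x \<in> space (arr_dom F). w1 x \<noteq> w2 x} = 0"
    by (subst (asm) AE_iff_measurable[OF _ refl]) auto
  then show ?thesis
    using i by (auto simp: rv_sim_def measure_def)
qed

end

theory Submission
  imports Defs
begin

text \<open>Pulling a measurable set back along the identity returns the same set, so
  \<open>u\<close> satisfies the defining integral equation of its own conditional expectation. Any
  two versions agree almost surely (\<open>is_cond_exp_along_unique\<close>), hence so do
  \<open>u\<close> and the chosen one.\<close>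

lemma is_cond_exp_along_prob_id:
  assumes "u \<in> L1 X"
  shows "is_cond_exp_along (prob_id X) u u"
proof -
  have "(\<lambda>x\<in>space X. x) -` A \<inter> space X = A" if "A \<in> sets X" for A
    using sets.sets_into_space[OF that] by auto
  then show ?thesis
    using assms by (simp add: is_cond_exp_along_def prob_id_def)
qed

theorem proposition3p2:
  fixes X :: "'a measure" and u :: "'a \<Rightarrow> real"
  assumes "prob_space X"
    and "u \<in> L1 X"
  shows "rv_sim X (cond_exp_along (prob_id X) u) u"
proof -
  have u: "is_cond_exp_along (prob_id X) u u"
    using assms(2) by (rule is_cond_exp_along_prob_id)
  \<comment> \<open>Since \<open>u\<close> is a version, the choice by \<open>SOME\<close> ranges
    over a nonempty set and yields a version.\<close>
  then have "is_cond_exp_along (prob_id X) u (cond_exp_along (prob_id X) u)"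
    unfolding cond_exp_along_def by (rule someI[of "is_cond_exp_along (prob_id X) u"])
  from is_cond_exp_along_unique[OF this u] show ?thesis
    by (simp add: prob_id_def)
qed

end
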